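(* Let $(\mathfrak{J},\alpha,\omega)$ be a cosymplectic JJ-algebra with product $\cdot$, and let $(\varphi,a)$ be an admissible pair of $(\mathfrak{J},\cdot)$ with $\alpha(a)=0$. Let $\tilde{\mathfrak{J}}=\langle d\rangle\oplus\mathfrak{J}\oplus\langle e\rangle$ be equipped with the commutative product $$x\bullet y=x\cdot y,\qquad d\bullet x=\varphi(x)+\tfrac12\omega(a,x)e,\qquad d\bullet d=a\in\mathfrak{J},$$ for all $x,y\in\mathfrak{J}$ (all products with $e$ being zero). If $\omega_\varphi=0$ and $\frac12\omega(a,\cdot)=-\alpha\circ\varphi$, then, for every $t\in\mathbb{K}$, $$\tilde\alpha=\alpha+e^*+t\,d^*,\qquad\tilde\omega=\omega+d^*\wedge e^*$$ defines a cosymplectic structure on $\tilde{\mathfrak{J}}$.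
   Context: All algebras are finite-dimensional over a field $\mathbb{K}$ of characteristic different from $2$ and $3$. A JJ-algebra is a vector space $\mathfrak{J}$ with a commutative bilinear product $\cdot$ satisfying $x\cdot(y\cdot z)+y\cdot(z\cdot x)+z\cdot(x\cdot y)=0$ for all $x,y,z$. An anti-derivation of $(\mathfrak{J},\cdot)$ is a linear map $\mathrm D$ with $\mathrm{D}(x\cdot y)=-\mathrm{D}(x)\cdot y-x\cdot\mathrm{D}(y)$. An admissible pair of $(\mathfrak{J},\cdot)$ is a pair $(\varphi,a)$ with $\varphi$ an anti-derivation of $\mathfrak{J}$ and $a\in\ker(\varphi)$ such that $\varphi^2=-\frac12\mathrm{L}_a$, where $\mathrm{L}_a(x)=a\cdot x$. Notation: $\omega_\varphi(x,y)=\omega(\varphi(x),y)+\omega(\varphi(y),x)$. The linear forms $d^*,e^*$ on $\tilde{\mathfrak{J}}$ are dual to $d,e$ and vanish on $\mathfrak{J}$; $\alpha$ and $\omega$ are extended by zero on $d,e$; $(d^*\wedge e^* )(x,y)=d^*(x)e^*(y)-d^*(y)e^*(x)$. A cosymplectic structure on a JJ-algebra $(\mathfrak{J},\cdot)$ of dimension $2n+1$ is a pair $(\alpha,\omega)$ with $\alpha$ a linear form and $\omega$ a skew-symmetric bilinear form such that $\alpha(x\cdot y)=0$ and $\omega(x\cdot y,z)+\omega(z\cdot x,y)+\omega(y\cdot z,x)=0$ for all $x,y,z\in\mathfrak{J}$, and the volume condition "$\alpha\wedge\omega^n\neq0$" holds, understood as: the linear map $\Psi:\mathfrak{J}\to\mathfrak{J}^*$,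 $\Psi(x)=\omega(x,\cdot)+\alpha(x)\alpha(\cdot)$, is an isomorphism (equivalent to $\alpha\wedge\omega^n\ne0$ whenever $n!$ is invertible in $\mathbb{K}$). The conclusion includes that $(\tilde{\mathfrak{J}},\bullet)$ is a JJ-algebra. *)

theory Defs
  imports "HOL-Analysis.Product_Vector"
begin

definition bilinear_map ::
    "('k::field \<Rightarrow> 'v::ab_group_add \<Rightarrow> 'v) \<Rightarrow> ('k \<Rightarrow> 'w::ab_group_add \<Rightarrow> 'w) \<Rightarrow> ('v \<Rightarrow> 'v \<Rightarrow> 'w) \<Rightarrow> bool"
  where "bilinear_map s1 s2 f \<longleftrightarrow>
    (\<forall>x. Vector_Spaces.linear s1 s2 (\<lambda>y. f x y)) \<and> (\<forall>y. Vector_Spaces.linear s1 s2 (\<lambda>x. f x y))"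

definition dual_space :: "('k::field \<Rightarrow> 'v::ab_group_add \<Rightarrow> 'v) \<Rightarrow> ('v \<Rightarrow> 'k) set"
  where "dual_space smul = {f. Vector_Spaces.linear smul (*) f}"

text \<open>The underlying vector space is the whole type \<open>'v\<close> with scalar multiplication \<open>smul\<close>.
  The standing assumptions (finite dimension, characteristic different from 2 and 3) are part
  of the locale.\<close>

locale JJ_algebra = vector_space smul
  for smul :: "'k::field \<Rightarrow> 'v::ab_group_add \<Rightarrow> 'v" +
  fixes mult :: "'v \<Rightarrow> 'v \<Rightarrow> 'v"
  assumes char_neq_2: "CHAR('k) \<noteq> 2"
    and char_neq_3: "CHAR('k) \<noteq> 3"
    and finite_dim: "\<exists>B. finite_dimensional_vector_space smul B"
    and bilinear_mult: "bilinear_map smul smul mult"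
    and mult_comm: "mult x y = mult y x"
    and JJ_identity: "mult x (mult y z) + mult y (mult z x) + mult z (mult x y) = 0"

definition anti_derivation ::
    "('k::field \<Rightarrow> 'v::ab_group_add \<Rightarrow> 'v) \<Rightarrow> ('v \<Rightarrow> 'v \<Rightarrow> 'v) \<Rightarrow> ('v \<Rightarrow> 'v) \<Rightarrow> bool"
  where "anti_derivation smul mult D \<longleftrightarrow>
    Vector_Spaces.linear smul smul D \<and> (\<forall>x y. D (mult x y) = - mult (D x) y - mult x (D y))"

definition admissible_pair ::
    "('k::field \<Rightarrow> 'v::ab_group_add \<Rightarrow> 'v) \<Rightarrow> ('v \<Rightarrow> 'v \<Rightarrow> 'v) \<Rightarrow> ('v \<Rightarrow> 'v) \<Rightarrow> 'v \<Rightarrow> bool"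
  where "admissible_pair smul mult \<phi> a \<longleftrightarrow>
    anti_derivation smul mult \<phi> \<and> \<phi> a = 0 \<and> (\<forall>x. \<phi> (\<phi> x) = smul (- (1 / 2)) (mult a x))"

definition form_twist :: "('v \<Rightarrow> 'v \<Rightarrow> 'k::field) \<Rightarrow> ('v \<Rightarrow> 'v) \<Rightarrow> 'v \<Rightarrow> 'v \<Rightarrow> 'k"
  where "form_twist \<omega> \<phi> x y = \<omega> (\<phi> x) y + \<omega> (\<phi> y) x"

text \<open>The condition \<open>\<alpha> \<and> \<omega>\<^sup>n \<noteq> 0\<close> is expressed by \<open>volume\<close>: the map
  \<open>x \<mapsto> \<omega>(x,\<cdot>) + \<alpha>(x)\<alpha>\<close>, which is linear because \<open>\<alpha>\<close> and \<open>\<omega>\<close> are, is an isomorphism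
  onto the dual space.\<close>

locale cosymplectic_JJ_algebra = JJ_algebra smul mult
  for smul :: "'k::field \<Rightarrow> 'v::ab_group_add \<Rightarrow> 'v" and mult :: "'v \<Rightarrow> 'v \<Rightarrow> 'v" +
  fixes \<alpha> :: "'v \<Rightarrow> 'k" and \<omega> :: "'v \<Rightarrow> 'v \<Rightarrow> 'k"
  assumes odd_dim: "\<exists>n. dim (UNIV :: 'v set) = 2 * n + 1"
    and linear_form: "Vector_Spaces.linear smul (*) \<alpha>"
    and bilinear_form: "bilinear_map smul (*) \<omega>"
    and skew: "\<omega> x y = - \<omega> y x"
    and \<alpha>_mult: "\<alpha> (mult x y) = 0"
    and \<omega>_cyclic: "\<omega> (mult x y) z + \<omega> (mult z x) y + \<omega> (mult y z) x = 0"
    and volume: "bij_betw (\<lambda>x y. \<omega> x y + \<alpha> x * \<alpha> y) UNIV (dual_space smul)"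

text \<open>The space \<open>\<langle>d\<rangle> \<oplus> J \<oplus> \<langle>e\<rangle>\<close> is modelled as \<open>'k \<times> 'v \<times> 'k\<close>; the triple
  \<open>(r, x, s)\<close> stands for \<open>r d + x + s e\<close>.\<close>

definition ext_scale ::
    "('k::field \<Rightarrow> 'v::ab_group_add \<Rightarrow> 'v) \<Rightarrow> 'k \<Rightarrow> 'k \<times> 'v \<times> 'k \<Rightarrow> 'k \<times> 'v \<times> 'k"
  where "ext_scale smul = module_prod.scale (*) (module_prod.scale smul (*))"

definition ext_d :: "'k::field \<times> 'v::ab_group_add \<times> 'k" where "ext_d = (1, 0, 0)"
definition ext_e :: "'k::field \<times> 'v::ab_group_add \<times> 'k" where "ext_e = (0, 0, 1)"
definition ext_in :: "'v::ab_group_add \<Rightarrow> 'k::field \<times> 'v \<times> 'k" where "ext_in x = (0, x, 0)"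

definition ext_proj :: "'k::field \<times> 'v::ab_group_add \<times> 'k \<Rightarrow> 'v" where "ext_proj u = fst (snd u)"
definition d_star :: "'k::field \<times> 'v::ab_group_add \<times> 'k \<Rightarrow> 'k" where "d_star u = fst u"
definition e_star :: "'k::field \<times> 'v::ab_group_add \<times> 'k \<Rightarrow> 'k" where "e_star u = snd (snd u)"

definition wedge :: "('u \<Rightarrow> 'k::field) \<Rightarrow> ('u \<Rightarrow> 'k) \<Rightarrow> 'u \<Rightarrow> 'u \<Rightarrow> 'k"
  where "wedge f g u v = f u * g v - f v * g u"

text \<open>The commutative bilinear extension of \<open>x \<bullet> y = x \<cdot> y\<close>,
  \<open>d \<bullet> x = \<phi>(x) + \<omega>(a,x)/2 e\<close>, \<open>d \<bullet> d = a\<close>, \<open>e \<bullet> u = 0\<close>; see the lemmas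
  \<open>ext_mult_values\<close>, \<open>bilinear_ext_mult\<close> and \<open>ext_mult_unique\<close>.\<close>

definition ext_mult ::
    "('k::field \<Rightarrow> 'v::ab_group_add \<Rightarrow> 'v) \<Rightarrow> ('v \<Rightarrow> 'v \<Rightarrow> 'v) \<Rightarrow> ('v \<Rightarrow> 'v \<Rightarrow> 'k) \<Rightarrow> ('v \<Rightarrow> 'v) \<Rightarrow> 'v \<Rightarrow>
      'k \<times> 'v \<times> 'k \<Rightarrow> 'k \<times> 'v \<times> 'k \<Rightarrow> 'k \<times> 'v \<times> 'k"
  where "ext_mult smul mult \<omega> \<phi> a = (\<lambda>(r, x, s) (r', x', s').
    (0,
     mult x x' + smul r (\<phi> x') + smul r' (\<phi> x) + smul (r * r') a,
     1 / 2 * (r * \<omega> a x' + r' * \<omega> a x)))"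

definition ext_alpha :: "('v::ab_group_add \<Rightarrow> 'k::field) \<Rightarrow> 'k \<Rightarrow> 'k \<times> 'v \<times> 'k \<Rightarrow> 'k"
  where "ext_alpha \<alpha> t u = \<alpha> (ext_proj u) + e_star u + t * d_star u"

definition ext_omega ::
    "('v::ab_group_add \<Rightarrow> 'v \<Rightarrow> 'k::field) \<Rightarrow> 'k \<times> 'v \<times> 'k \<Rightarrow> 'k \<times> 'v \<times> 'k \<Rightarrow> 'k"
  where "ext_omega \<omega> u v = \<omega> (ext_proj u) (ext_proj v) + wedge d_star e_star u v"

context
  fixes smul :: "'k::field \<Rightarrow> 'v::ab_group_add \<Rightarrow> 'v"
  assumes vs: "vector_space smul"
begin

interpretation vector_space smul by (rule vs)

lemma vector_space_field: "vector_space ((*) :: 'k \<Rightarrow> 'k \<Rightarrow> 'k)"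
  by unfold_locales (simp_all add: algebra_simps)

lemma ext_scale_Pair: "ext_scale smul c (r, x, s) = (c * r, smul c x, c * s)"
proof -
  interpret K: vector_space "(*) :: 'k \<Rightarrow> 'k \<Rightarrow> 'k" by (rule vector_space_field)
  interpret P: vector_space_prod smul "(*) :: 'k \<Rightarrow> 'k \<Rightarrow> 'k" by unfold_locales
  interpret Q: vector_space_prod "(*) :: 'k \<Rightarrow> 'k \<Rightarrow> 'k" P.scale by unfold_locales
  show ?thesis unfolding ext_scale_def by (simp add: P.scale_prod Q.scale_prod)
qed

lemma vector_space_ext: "vector_space (ext_scale smul)"
  by unfold_locales (auto simp: ext_scale_Pair algebra_simps)

context
  fixes mult :: "'v \<Rightarrow> 'v \<Rightarrow> 'v" and \<omega> :: "'v \<Rightarrow> 'v \<Rightarrow> 'k" and \<phi> :: "'v \<Rightarrow> 'v"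
  assumes mult: "bilinear_map smul smul mult" and comm: "\<And>x y. mult x y = mult y x"
    and omega: "bilinear_map smul (*) \<omega>"
    and phi: "Vector_Spaces.linear smul smul \<phi>"
begin

lemma hom_mult1: "module_hom smul smul (mult x)"
  using mult module_hom_iff_linear unfolding bilinear_map_def by metis

lemma hom_mult2: "module_hom smul smul (\<lambda>x. mult x y)"
  using mult module_hom_iff_linear unfolding bilinear_map_def by metis

lemma hom_omega: "module_hom smul (*) (\<omega> x)"
  using omega module_hom_iff_linear unfolding bilinear_map_def by metis

lemma hom_phi: "module_hom smul smul \<phi>"
  using phi module_hom_iff_linear by metis

lemmas ext_simps =
  module_hom.add[OF hom_mult1] module_hom.add[OF hom_mult2] module_hom.add[OF hom_omega]
  module_hom.add[OF hom_phi] module_hom.scale[OF hom_mult1] module_hom.scale[OF hom_mult2]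
  module_hom.scale[OF hom_omega] module_hom.scale[OF hom_phi]
  module_hom.zero[OF hom_mult1] module_hom.zero[OF hom_mult2] module_hom.zero[OF hom_omega]
  module_hom.zero[OF hom_phi]

lemma ext_mult_values:
  "ext_mult smul mult \<omega> \<phi> a (ext_in x) (ext_in y) = ext_in (mult x y)"
  "ext_mult smul mult \<omega> \<phi> a ext_d (ext_in x) =
     ext_in (\<phi> x) + ext_scale smul (1 / 2 * \<omega> a x) ext_e"
  "ext_mult smul mult \<omega> \<phi> a ext_d ext_d = ext_in a"
  "ext_mult smul mult \<omega> \<phi> a ext_e u = 0"
  by (auto simp: ext_mult_def ext_in_def ext_d_def ext_e_def ext_scale_Pair ext_simps
      zero_prod_def split: prod.splits)

lemma ext_mult_comm: "ext_mult smul mult \<omega> \<phi> a u v = ext_mult smul mult \<omega> \<phi> a v u"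
  by (auto simp: ext_mult_def comm algebra_simps split: prod.splits)

lemma bilinear_ext_mult:
  "bilinear_map (ext_scale smul) (ext_scale smul) (ext_mult smul mult \<omega> \<phi> a)"
proof -
  interpret E: vector_space "ext_scale smul" by (rule vector_space_ext)
  have l: "Vector_Spaces.linear (ext_scale smul) (ext_scale smul) (ext_mult smul mult \<omega> \<phi> a u)"
    for u
    by unfold_locales
      (auto simp: ext_mult_def ext_scale_Pair ext_simps algebra_simps add_divide_distrib split: prod.splits)
  then show ?thesis
    unfolding bilinear_map_def using ext_mult_comm[of a] by simp
qed

lemma ext_mult_unique:
  assumes m: "bilinear_map (ext_scale smul) (ext_scale smul) m"
    and c: "\<And>u v. m u v = m v u"
    and xy: "\<And>x y. m (ext_in x) (ext_in y) = ext_in (mult x y)"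
    and dx: "\<And>x. m ext_d (ext_in x) = ext_in (\<phi> x) + ext_scale smul (1 / 2 * \<omega> a x) ext_e"
    and dd: "m ext_d ext_d = ext_in a"
    and e: "\<And>u. m ext_e u = 0"
  shows "m = ext_mult smul mult \<omega> \<phi> a"
proof -
  interpret E: vector_space "ext_scale smul" by (rule vector_space_ext)
  have h1: "module_hom (ext_scale smul) (ext_scale smul) (m u)" for u
    using m unfolding bilinear_map_def module_hom_iff_linear by blast
  have h2: "module_hom (ext_scale smul) (ext_scale smul) (\<lambda>u. m u v)" for v
    using m unfolding bilinear_map_def module_hom_iff_linear by blast
  have e': "m u ext_e = 0" for u
    using e c by metis
  have xd: "m (ext_in x) ext_d = ext_in (\<phi> x) + ext_scale smul (1 / 2 * \<omega> a x) ext_e" for x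
    using dx c by metis
  have dec: "(r, x, s) = ext_scale smul r ext_d + ext_in x + ext_scale smul s ext_e" for r s x
    by (simp add: ext_in_def ext_d_def ext_e_def ext_scale_Pair)
  have "m (r, x, s) (r', x', s') = ext_mult smul mult \<omega> \<phi> a (r, x, s) (r', x', s')"
    for r x s r' x' s'
    unfolding dec[of r x s] dec[of r' x' s']
    by (simp only: module_hom.add[OF h1] module_hom.add[OF h2] module_hom.scale[OF h1]
        module_hom.scale[OF h2] xy dx xd dd e e')
      (simp add: ext_mult_def ext_in_def ext_d_def ext_e_def ext_scale_Pair zero_prod_def
        ext_simps algebra_simps add_divide_distrib)
  then show ?thesis by (auto simp: fun_eq_iff)
qed

end

end

end

theory Submission
  imports Defs
begin

text \<open>
  Write an element of the extension as \<open>r d + x + s e\<close>. The identities for the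
  extended product and forms are polynomial in the coefficients \<open>r\<close> of the arguments, and they hold
  because each coefficient vanishes separately.

  For the JJ identity (\<open>ext_JJ_algebra\<close>), the component in \<open>J\<close> uses exactly that \<open>J\<close> is a JJ-algebra
  and that \<open>(\<phi>, a)\<close> is admissible. The component along \<open>e\<close> vanishes once \<open>\<omega>(a,\<cdot>)\<close> is zero at \<open>a\<close>,
  on the image of \<open>\<phi>\<close> and on products. All three follow from \<open>\<omega>(a,\<cdot>) = - 2 \<alpha> \<circ> \<phi>\<close>: the map \<open>\<phi>\<close>
  kills \<open>a\<close>, and it sends both \<open>\<phi> x\<close> and \<open>x \<cdot> y\<close> to linear combinations of products, where
  \<open>\<alpha>\<close> vanishes.

  The extended \<open>\<alpha>\<close> vanishes on products because the \<open>e\<close>-component \<open>\<omega>(a,x) / 2\<close> of \<open>d \<bullet> x\<close> cancels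
  \<open>\<alpha> (\<phi> x)\<close>, and \<open>\<alpha>(a) = 0\<close> accounts for \<open>d \<bullet> d\<close>. In the cyclic
  identity for the extended \<open>\<omega>\<close> the terms with one factor \<open>d\<close> are values of \<open>\<omega>\<^sub>\<phi>\<close>; those with
  two, \<open>\<omega>(a,x)\<close> from \<open>d \<bullet> d\<close> and twice \<open>- \<omega>(a,x) / 2\<close> from \<open>d \<bullet> x\<close>, cancel.

  The volume condition (\<open>ext_volume\<close>) is obtained by solving the linear system that expresses that
  \<open>\<Psi>(r d + x + s e)\<close> is a given form on the extension. The key unknown is the scalar
  \<open>A = \<alpha>(x) + s + t r\<close>, the value of the extended \<open>\<alpha>\<close>. The equations at \<open>d\<close> and \<open>e\<close> express
  \<open>r\<close> and \<open>s\<close> through \<open>A\<close>, and substituting them back, the terms \<open>t A\<close> cancel: \<open>A\<close> is \<open>\<alpha>(x)\<close> plus a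
  known constant. What remains is an equation for \<open>\<Psi>(x)\<close> on \<open>J\<close>, uniquely solvable by assumption.
\<close>

section \<open>Linear algebra on the double extension\<close>

lemma finite_dimensional_field:
  "finite_dimensional_vector_space ((*) :: 'k::field \<Rightarrow> 'k \<Rightarrow> 'k) {1}"
proof -
  interpret K: vector_space "(*) :: 'k \<Rightarrow> 'k \<Rightarrow> 'k"
    by unfold_locales (simp_all add: algebra_simps)
  show ?thesis
    by unfold_locales (auto simp: K.span_singleton)
qed

lemma ext_finite_dimensional:
  fixes smul :: "'k::field \<Rightarrow> 'v::ab_group_add \<Rightarrow> 'v"
  assumes "finite_dimensional_vector_space smul B"
  shows "\<exists>B'. finite_dimensional_vector_space (ext_scale smul) B'"
    and "vector_space.dim (ext_scale smul) (UNIV :: ('k \<times> 'v \<times> 'k) set) =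
      vector_space.dim smul (UNIV :: 'v set) + 2"
proof -
  interpret V: finite_dimensional_vector_space smul B by fact
  interpret K: finite_dimensional_vector_space "(*) :: 'k \<Rightarrow> 'k \<Rightarrow> 'k" "{1}"
    by (rule finite_dimensional_field)
  interpret P: finite_dimensional_vector_space_prod smul "(*) :: 'k \<Rightarrow> 'k \<Rightarrow> 'k" B "{1}"
    by unfold_locales
  interpret Q: finite_dimensional_vector_space_prod
    "(*) :: 'k \<Rightarrow> 'k \<Rightarrow> 'k" P.scale "{1}" P.Basis_pair
    by unfold_locales
  show "\<exists>B'. finite_dimensional_vector_space (ext_scale smul) B'"
    unfolding ext_scale_def using Q.p.finite_dimensional_vector_space_axioms by blast
  have "K.dim UNIV = 1"
    by (simp add: K.dim_UNIV)
  then show "vector_space.dim (ext_scale smul) (UNIV :: ('k \<times> 'v \<times> 'k) set) = V.dim UNIV + 2"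
    using P.dim_Times[OF V.subspace_UNIV K.subspace_UNIV]
      Q.dim_Times[OF K.subspace_UNIV P.p.subspace_UNIV]
    by (simp add: ext_scale_def)
qed

text \<open>These are instances of the general laws for linear maps. They are listed separately because
  interpreting the base field as a vector space over itself turns associativity of \<open>*\<close> into a
  rewrite rule opposite to the one in \<open>algebra_simps\<close>.\<close>

lemma linear_form_simps:
  fixes smul :: "'k::field \<Rightarrow> 'v::ab_group_add \<Rightarrow> 'v"
  assumes "Vector_Spaces.linear smul (*) f"
  shows "f (x + y) = f x + f y" "f (x - y) = f x - f y" "f (- x) = - f x"
    and "f (smul c x) = c * f x" "f 0 = 0"
proof -
  interpret Vector_Spaces.linear smul "(*)" f by fact
  show "f (x + y) = f x + f y" "f (x - y) = f x - f y" "f (- x) = - f x"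
    "f (smul c x) = c * f x" "f 0 = 0"
    by (rule add diff neg scale zero)+
qed

lemma linear_ext_alpha:
  assumes "Vector_Spaces.linear smul (*) \<alpha>"
  shows "Vector_Spaces.linear (ext_scale smul) (*) (ext_alpha \<alpha> t)"
proof -
  have vs: "vector_space smul" "vector_space ((*) :: 'a \<Rightarrow> 'a \<Rightarrow> 'a)"
    using assms by (auto simp: Vector_Spaces.linear_iff)
  show ?thesis
    unfolding Vector_Spaces.linear_iff
    using vector_space_ext[OF vs(1)] vs(2)
    by (auto simp: ext_scale_Pair[OF vs(1)] ext_alpha_def ext_proj_def
        d_star_def e_star_def linear_form_simps[OF assms] algebra_simps)
qed

lemma bilinear_ext_omega:
  assumes "bilinear_map smul (*) \<omega>"
  shows "bilinear_map (ext_scale smul) (*) (ext_omega \<omega>)"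
proof -
  have l: "Vector_Spaces.linear smul (*) (\<omega> x)" "Vector_Spaces.linear smul (*) (\<lambda>x. \<omega> x y)" for x y
    using assms by (auto simp: bilinear_map_def)
  then have vs: "vector_space smul" "vector_space ((*) :: 'a \<Rightarrow> 'a \<Rightarrow> 'a)"
    by (auto simp: Vector_Spaces.linear_iff)
  note s = l[unfolded Vector_Spaces.linear_iff]
  show ?thesis
    unfolding bilinear_map_def Vector_Spaces.linear_iff
    using vector_space_ext[OF vs(1)] vs(2) s
    by (auto simp: ext_scale_Pair[OF vs(1)] ext_omega_def wedge_def ext_proj_def
        d_star_def e_star_def algebra_simps)
qed

text \<open>The linear system behind the volume condition, solved: the given form has value \<open>p\<close> at \<open>d\<close>,
  \<open>q\<close> at \<open>e\<close> and restricts to \<open>f\<close>. With \<open>A\<close> the value of the extended \<open>\<alpha>\<close> at the unknown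
  \<open>(r, x, s)\<close>, evaluation at \<open>d\<close>, at \<open>J\<close> and at \<open>e\<close> gives \<open>t A - s = p\<close>, \<open>\<omega>(x,\<cdot>) + A \<alpha> = f\<close> and
  \<open>r + A = q\<close>; eliminating \<open>r\<close> and \<open>s\<close> from \<open>A = \<alpha> x + s + t r\<close> leaves \<open>A = \<alpha> x + (t q - p)\<close>.\<close>

lemma ext_volume_eq_iff:
  fixes \<alpha> f :: "'v::ab_group_add \<Rightarrow> 'k::field" and \<omega> :: "'v \<Rightarrow> 'v \<Rightarrow> 'k"
  assumes zero: "\<And>x. \<omega> x 0 = 0" "\<alpha> 0 = 0" "f 0 = 0"
  shows "(\<forall>r' y s'. ext_omega \<omega> (r, x, s) (r', y, s')
            + ext_alpha \<alpha> t (r, x, s) * ext_alpha \<alpha> t (r', y, s') = p * r' + f y + q * s') \<longleftrightarrow>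
    (\<forall>y. \<omega> x y + \<alpha> x * \<alpha> y = f y - (t * q - p) * \<alpha> y) \<and>
    r = q - (\<alpha> x + (t * q - p)) \<and> s = t * (\<alpha> x + (t * q - p)) - p"
    (is "?L \<longleftrightarrow> ?R")
proof -
  define A where "A = ext_alpha \<alpha> t (r, x, s)"
  have A: "A = \<alpha> x + s + t * r"
    by (simp add: A_def ext_alpha_def ext_proj_def e_star_def d_star_def)
  have "?L \<longleftrightarrow> (\<forall>r' y s'. (t * A - s) * r' + (\<omega> x y + A * \<alpha> y) + (r + A) * s'
      = p * r' + f y + q * s')"
    unfolding A_def[symmetric]
    by (simp add: ext_omega_def wedge_def ext_alpha_def ext_proj_def e_star_def d_star_def
        algebra_simps)
  also have "\<dots> \<longleftrightarrow> t * A - s = p \<and> (\<forall>y. \<omega> x y + A * \<alpha> y = f y) \<and> r + A = q"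
    (is "?M \<longleftrightarrow> ?N")
  proof
    assume m: ?M
    show ?N
      using m[rule_format, of 1 0 0] m[rule_format, of 0 _ 0] m[rule_format, of 0 0 1] zero
      by simp
  qed auto
  also have "\<dots> \<longleftrightarrow> ?R"
  proof
    assume n: ?N
    then have s: "s = t * A - p" and r: "r = q - A"
      by (simp_all add: eq_diff_eq diff_eq_eq add.commute)
    have A': "A = \<alpha> x + (t * q - p)"
      using A unfolding s r by (simp add: right_diff_distrib)
    from n have "\<forall>y. \<omega> x y + (\<alpha> x + (t * q - p)) * \<alpha> y = f y"
      unfolding A' by blast
    then show ?R
      using s r unfolding A' by (simp add: distrib_right eq_diff_eq add.assoc)
  next
    assume R: ?R
    then have s: "s = t * (\<alpha> x + (t * q - p)) - p" and r: "r = q - (\<alpha> x + (t * q - p))"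
      by blast+
    have A': "A = \<alpha> x + (t * q - p)"
      unfolding A s r by (simp add: algebra_simps)
    have "\<forall>y. \<omega> x y + A * \<alpha> y = f y"
      using R unfolding A' by (simp add: distrib_right eq_diff_eq add.assoc)
    moreover have "t * A - s = p" "r + A = q"
      unfolding A' s r by simp_all
    ultimately show ?N by blast
  qed
  finally show ?thesis .
qed

text \<open>By the previous lemma every linear form has exactly one preimage, because the equation left
  for \<open>x\<close> has exactly one solution.\<close>

lemma ext_volume:
  fixes smul :: "'k::field \<Rightarrow> 'v::ab_group_add \<Rightarrow> 'v"
  assumes \<alpha>: "Vector_Spaces.linear smul (*) \<alpha>"
    and \<omega>: "bilinear_map smul (*) \<omega>"
    and vol: "bij_betw (\<lambda>x y. \<omega> x y + \<alpha> x * \<alpha> y) UNIV (dual_space smul)"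
  shows "bij_betw (\<lambda>u v. ext_omega \<omega> u v + ext_alpha \<alpha> t u * ext_alpha \<alpha> t v)
    UNIV (dual_space (ext_scale smul))"
proof (rule bij_betwI')
  have vs: "vector_space smul" and K: "vector_space ((*) :: 'k \<Rightarrow> 'k \<Rightarrow> 'k)"
    using \<alpha> by (auto simp: Vector_Spaces.linear_iff)
  note scale = ext_scale_Pair[OF vs]
  have smul_0: "smul c 0 = 0" for c
  proof -
    interpret V: vector_space smul by (rule vs)
    show ?thesis by (rule V.scale_zero_right)
  qed
  let ?\<Psi> = "\<lambda>x y. \<omega> x y + \<alpha> x * \<alpha> y"
  let ?\<Psi>' = "\<lambda>u v. ext_omega \<omega> u v + ext_alpha \<alpha> t u * ext_alpha \<alpha> t v"
  have \<omega>0: "\<omega> x 0 = 0" for x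
    using \<omega> linear_form_simps(5)[of smul "\<omega> x"] by (simp add: bilinear_map_def)
  show dual: "?\<Psi>' u \<in> dual_space (ext_scale smul)" for u
  proof -
    have "Vector_Spaces.linear (ext_scale smul) (*) (ext_omega \<omega> u)"
      using bilinear_ext_omega[OF \<omega>] unfolding bilinear_map_def by blast
    then show ?thesis
      using linear_ext_alpha[OF \<alpha>, of t]
      unfolding dual_space_def Vector_Spaces.linear_iff by (simp add: algebra_simps)
  qed
  have unique_solution: "\<exists>!u. ?\<Psi>' u = F" if "F \<in> dual_space (ext_scale smul)" for F
  proof -
    have F_add: "F (u + v) = F u + F v" and F_scale: "F (ext_scale smul c u) = c * F u" for u v c
      using that linear_form_simps[of "ext_scale smul" F] by (simp_all add: dual_space_def)
    define p f q where "p = F ext_d" and "f = (\<lambda>y. F (ext_in y))" and "q = F ext_e"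
    have "(r, y, s) = ext_scale smul r ext_d + ext_in y + ext_scale smul s ext_e" for r y s
      by (simp add: ext_in_def ext_d_def ext_e_def scale smul_0)
    then have F: "F (r, y, s) = p * r + f y + q * s" for r y s
      by (simp add: F_add F_scale p_def f_def q_def mult.commute)
    have f_add: "f (x + y) = f x + f y" for x y
      using F_add[of "ext_in x" "ext_in y"] by (simp add: f_def ext_in_def)
    have f_scale: "f (smul c x) = c * f x" for x c
      using F_scale[of c "ext_in x"] by (simp add: f_def ext_in_def scale)
    have f0: "f 0 = 0"
      using f_scale[of 0 0] by (simp add: smul_0)
    let ?g = "\<lambda>y. f y - (t * q - p) * \<alpha> y"
    have "?g \<in> dual_space smul"
      using vs K by (simp add: dual_space_def Vector_Spaces.linear_iff f_add f_scale
          linear_form_simps[OF \<alpha>] algebra_simps)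
    moreover have "\<exists>!x. h x = g" if "bij_betw h UNIV S" "g \<in> S"
      for h :: "'v \<Rightarrow> 'v \<Rightarrow> 'k" and g S
      using that unfolding bij_betw_def inj_on_def by (metis UNIV_I imageE)
    ultimately have ex1: "\<exists>!x. ?\<Psi> x = ?g"
      using vol by blast
    have eq: "?\<Psi>' (r, x, s) = F \<longleftrightarrow>
        ?\<Psi> x = ?g \<and> r = q - (\<alpha> x + (t * q - p)) \<and> s = t * (\<alpha> x + (t * q - p)) - p" for r x s
      using ext_volume_eq_iff[of \<omega> \<alpha> f r x s t p q, OF \<omega>0 linear_form_simps(5)[OF \<alpha>] f0]
      by (simp add: fun_eq_iff F)
    from ex1 obtain x where x: "?\<Psi> x = ?g" and x_unique: "\<And>x'. ?\<Psi> x' = ?g \<Longrightarrow> x' = x"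
      by blast
    show ?thesis
    proof (rule ex1I)
      show "?\<Psi>' (q - (\<alpha> x + (t * q - p)), x, t * (\<alpha> x + (t * q - p)) - p) = F"
        using x by (simp only: eq)
    next
      fix u assume u: "?\<Psi>' u = F"
      obtain r x' s where u': "u = (r, x', s)" by (cases u)
      show "u = (q - (\<alpha> x + (t * q - p)), x, t * (\<alpha> x + (t * q - p)) - p)"
        using u x_unique[of x'] unfolding u' eq by blast
    qed
  qed
  show "(?\<Psi>' u = ?\<Psi>' v) = (u = v)" for u v
  proof
    assume "?\<Psi>' u = ?\<Psi>' v"
    then show "u = v"
      using unique_solution[OF dual[of v]] by blast
  qed simp
  show "\<exists>u\<in>UNIV. F = ?\<Psi>' u" if "F \<in> dual_space (ext_scale smul)" for F
    using unique_solution[OF that] by blast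
qed

section \<open>The product of the double extension\<close>

lemma two_neq_0:
  assumes "CHAR('k::field) \<noteq> 2"
  shows "(2 :: 'k) \<noteq> 0"
proof
  assume "(2 :: 'k) = 0"
  then have "CHAR('k) dvd 2"
    using of_nat_eq_0_iff_char_dvd[where ?'a = 'k, of 2] by simp
  moreover have "CHAR('k) \<noteq> 1"
    using CHAR_not_1[where ?'a = 'k] by simp
  moreover have "n = 1 \<or> n = 2" if "n dvd 2" for n :: nat
    using that dvd_imp_le[of n 2] by (cases "n = 0") auto
  ultimately show False
    using assms by blast
qed

text \<open>Taking \<open>d\<close>-components \<open>r\<^sub>1, r\<^sub>2, r\<^sub>3\<close> of three arguments, the cyclic sum is a
  polynomial in the \<open>r\<^sub>i\<close>. Its \<open>J\<close>-part has one coefficient for each hypothesis: the JJ identity of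
  \<open>J\<close> in degree 0, the anti-derivation rule in degree 1, \<open>\<phi>\<^sup>2 = - L\<^sub>a / 2\<close> in degree 2 and
  \<open>\<phi> a = 0\<close> in degree 3. The \<open>e\<close>-part only contains the values of \<open>\<omega>(a,\<cdot>)\<close> at products, at the
  image of \<open>\<phi>\<close> and at \<open>a\<close>.\<close>

lemma (in JJ_algebra) ext_JJ_algebra:
  fixes \<omega> :: "'v \<Rightarrow> 'v \<Rightarrow> 'k"
  assumes adm: "admissible_pair smul mult \<phi> a"
    and \<omega>: "bilinear_map smul (*) \<omega>"
    and \<omega>_a: "\<omega> a a = 0" "\<And>x. \<omega> a (\<phi> x) = 0" "\<And>x y. \<omega> a (mult x y) = 0"
  shows "JJ_algebra (ext_scale smul) (ext_mult smul mult \<omega> \<phi> a)"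
proof -
  have vs: "vector_space smul" by unfold_locales
  have two: "(2 :: 'k) \<noteq> 0" by (rule two_neq_0[OF char_neq_2])
  have \<phi>: "Vector_Spaces.linear smul smul \<phi>"
    and \<phi>_mult: "\<And>x y. \<phi> (mult x y) = - mult (\<phi> x) y - mult x (\<phi> y)"
    and \<phi>_a: "\<phi> a = 0" and \<phi>\<phi>: "\<And>x. \<phi> (\<phi> x) = smul (- (1 / 2)) (mult a x)"
    using adm by (auto simp: admissible_pair_def anti_derivation_def)
  note ctx = vs bilinear_mult mult_comm \<omega> \<phi>
  note simps = ext_simps[OF ctx]
  interpret E: vector_space "ext_scale smul" by (rule vector_space_ext[OF vs])
  have half: "smul (1 / 2) x + smul (1 / 2) x = x" for x
    using two by (simp add: scale_left_distrib[symmetric] field_simps)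
  have jacobi_d: "\<phi> (mult x y) + mult x (\<phi> y) + mult y (\<phi> x) = 0" for x y
    by (simp add: \<phi>_mult mult_comm[of y])
  have jacobi_dd: "mult a x + \<phi> (\<phi> x) + \<phi> (\<phi> x) = 0" for x
    using half[of "mult a x"] by (simp add: \<phi>\<phi> algebra_simps)
  let ?m = "ext_mult smul mult \<omega> \<phi> a"
  show ?thesis
  proof
    show "CHAR('k) \<noteq> 2" "CHAR('k) \<noteq> 3" by (rule char_neq_2 char_neq_3)+
    show "\<exists>B. finite_dimensional_vector_space (ext_scale smul) B"
      using finite_dim ext_finite_dimensional(1) by blast
    show "bilinear_map (ext_scale smul) (ext_scale smul) ?m"
      by (rule bilinear_ext_mult[OF ctx])
    show "?m u v = ?m v u" for u v
      by (rule ext_mult_comm[OF ctx])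
    show "?m u (?m v w) + ?m v (?m w u) + ?m w (?m u v) = 0" for u v w
    proof -
      obtain r1 x1 s1 r2 x2 s2 r3 x3 s3
        where uvw: "u = (r1, x1, s1)" "v = (r2, x2, s2)" "w = (r3, x3, s3)"
        by (metis prod_cases3)
      have "snd (snd (?m u (?m v w) + ?m v (?m w u) + ?m w (?m u v))) = 0"
        by (simp add: uvw ext_mult_def simps \<omega>_a)
      moreover have "fst (snd (?m u (?m v w) + ?m v (?m w u) + ?m w (?m u v))) =
          (mult x1 (mult x2 x3) + mult x2 (mult x3 x1) + mult x3 (mult x1 x2))
        + smul r1 (\<phi> (mult x2 x3) + mult x2 (\<phi> x3) + mult x3 (\<phi> x2))
        + smul r2 (\<phi> (mult x3 x1) + mult x3 (\<phi> x1) + mult x1 (\<phi> x3))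
        + smul r3 (\<phi> (mult x1 x2) + mult x1 (\<phi> x2) + mult x2 (\<phi> x1))
        + smul (r2 * r3) (mult a x1 + \<phi> (\<phi> x1) + \<phi> (\<phi> x1))
        + smul (r3 * r1) (mult a x2 + \<phi> (\<phi> x2) + \<phi> (\<phi> x2))
        + smul (r1 * r2) (mult a x3 + \<phi> (\<phi> x3) + \<phi> (\<phi> x3))
        + smul (3 * r1 * r2 * r3) (\<phi> a)"
        by (simp add: uvw ext_mult_def simps mult_comm[of _ a] \<phi>_a scale_right_distrib
            mult.commute add_ac)
      moreover have "fst (?m u (?m v w) + ?m v (?m w u) + ?m w (?m u v)) = 0"
        by (simp add: uvw ext_mult_def)
      ultimately show ?thesis
        by (simp add: JJ_identity jacobi_d jacobi_dd \<phi>_a prod_eq_iff)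
    qed
  qed
qed

section \<open>The cosymplectic structure\<close>

text \<open>The relation \<open>\<omega>(a,\<cdot>) = - 2 \<alpha> \<circ> \<phi>\<close> is used twice: it turns the vanishing of \<open>\<alpha>\<close> on products
  into the vanishing of \<open>\<omega>(a,\<cdot>)\<close> that the JJ identity of the extension requires, and it makes
  the extended \<open>\<alpha>\<close> vanish on the products \<open>d \<bullet> x\<close>.\<close>

lemma (in cosymplectic_JJ_algebra) ext_cosymplectic_JJ_algebra:
  assumes adm: "admissible_pair smul mult \<phi> a"
    and \<alpha>_a: "\<alpha> a = 0"
    and twist: "\<And>x y. form_twist \<omega> \<phi> x y = 0"
    and \<omega>_a: "\<And>x. 1 / 2 * \<omega> a x = - \<alpha> (\<phi> x)"
  shows "cosymplectic_JJ_algebra (ext_scale smul) (ext_mult smul mult \<omega> \<phi> a)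
    (ext_alpha \<alpha> t) (ext_omega \<omega>)"
proof -
  have vs: "vector_space smul" by unfold_locales
  have two: "(2 :: 'k) \<noteq> 0" by (rule two_neq_0[OF char_neq_2])
  note \<alpha>_simps = linear_form_simps[OF linear_form]
  have \<phi>: "Vector_Spaces.linear smul smul \<phi>"
    and \<phi>_mult: "\<And>x y. \<phi> (mult x y) = - mult (\<phi> x) y - mult x (\<phi> y)"
    and \<phi>_a: "\<phi> a = 0" and \<phi>\<phi>: "\<And>x. \<phi> (\<phi> x) = smul (- (1 / 2)) (mult a x)"
    using adm by (auto simp: admissible_pair_def anti_derivation_def)
  have \<omega>_a': "\<omega> a x = - 2 * \<alpha> (\<phi> x)" for x
    using \<omega>_a[of x] two by (simp add: field_simps)
  have \<omega>_aa: "\<omega> a a = 0"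
    by (simp add: \<omega>_a' \<phi>_a \<alpha>_simps)
  have \<omega>_a_\<phi>: "\<omega> a (\<phi> x) = 0" for x
    by (simp add: \<omega>_a' \<phi>\<phi> \<alpha>_simps \<alpha>_mult)
  have \<omega>_a_mult: "\<omega> a (mult x y) = 0" for x y
    by (simp add: \<omega>_a' \<phi>_mult \<alpha>_simps \<alpha>_mult)
  interpret J: JJ_algebra "ext_scale smul" "ext_mult smul mult \<omega> \<phi> a"
    by (rule ext_JJ_algebra[OF adm bilinear_form \<omega>_aa \<omega>_a_\<phi> \<omega>_a_mult])
  have \<omega>_simps: "\<omega> (x + y) z = \<omega> x z + \<omega> y z" "\<omega> (smul c x) z = c * \<omega> x z" for x y z c
    using bilinear_form by (auto simp: bilinear_map_def Vector_Spaces.linear_iff)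
  let ?m = "ext_mult smul mult \<omega> \<phi> a"
  show ?thesis
  proof (intro cosymplectic_JJ_algebra.intro J.JJ_algebra_axioms
      cosymplectic_JJ_algebra_axioms.intro)
    obtain n where "dim (UNIV :: 'v set) = 2 * n + 1" using odd_dim by blast
    moreover obtain B where "finite_dimensional_vector_space smul B" using finite_dim by blast
    ultimately have "J.dim (UNIV :: ('k \<times> 'v \<times> 'k) set) = 2 * (n + 1) + 1"
      by (simp add: ext_finite_dimensional(2))
    then show "\<exists>n. J.dim (UNIV :: ('k \<times> 'v \<times> 'k) set) = 2 * n + 1" by blast
    show "Vector_Spaces.linear (ext_scale smul) (*) (ext_alpha \<alpha> t)"
      by (rule linear_ext_alpha[OF linear_form])
    show "bilinear_map (ext_scale smul) (*) (ext_omega \<omega>)"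
      by (rule bilinear_ext_omega[OF bilinear_form])
    show "ext_omega \<omega> u v = - ext_omega \<omega> v u" for u v
      using skew[of "ext_proj u" "ext_proj v"] by (simp add: ext_omega_def wedge_def)
    show "ext_alpha \<alpha> t (?m u v) = 0" for u v
      using two
      by (cases u; cases v) (simp add: ext_alpha_def ext_mult_def ext_proj_def d_star_def e_star_def
          \<alpha>_simps \<alpha>_mult \<alpha>_a \<omega>_a' field_simps)
    show "ext_omega \<omega> (?m u v) w + ext_omega \<omega> (?m w u) v + ext_omega \<omega> (?m v w) u = 0" for u v w
    proof -
      obtain r1 x1 s1 r2 x2 s2 r3 x3 s3
        where uvw: "u = (r1, x1, s1)" "v = (r2, x2, s2)" "w = (r3, x3, s3)"
        by (metis prod_cases3)
      \<comment> \<open>The contribution of \<open>d \<bullet> d = a\<close>, split so as to cancel against two terms of \<open>d\<^sup>* \<and> e\<^sup>*\<close>.\<close>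
      have half: "c * \<omega> a y = c * (1 / 2) * \<omega> a y + c * (1 / 2) * \<omega> a y" for c y
        using two by (simp add: field_simps)
      have "ext_omega \<omega> (?m u v) w + ext_omega \<omega> (?m w u) v + ext_omega \<omega> (?m v w) u =
          (\<omega> (mult x1 x2) x3 + \<omega> (mult x3 x1) x2 + \<omega> (mult x2 x3) x1)
        + r1 * (\<omega> (\<phi> x2) x3 + \<omega> (\<phi> x3) x2)
        + r2 * (\<omega> (\<phi> x1) x3 + \<omega> (\<phi> x3) x1)
        + r3 * (\<omega> (\<phi> x1) x2 + \<omega> (\<phi> x2) x1)"
        using half[of "r1 * r2" x3] half[of "r2 * r3" x1] half[of "r1 * r3" x2]
        by (simp add: uvw ext_mult_def ext_omega_def wedge_def ext_proj_def d_star_def e_star_def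
            \<omega>_simps algebra_simps)
      then show ?thesis
        using twist by (simp add: form_twist_def \<omega>_cyclic)
    qed
    show "bij_betw (\<lambda>u v. ext_omega \<omega> u v + ext_alpha \<alpha> t u * ext_alpha \<alpha> t v)
      UNIV (dual_space (ext_scale smul))"
      by (rule ext_volume[OF linear_form bilinear_form volume])
  qed
qed

theorem theorem4p2:
  fixes smul :: "'k::field \<Rightarrow> 'v::ab_group_add \<Rightarrow> 'v"
    and mult :: "'v \<Rightarrow> 'v \<Rightarrow> 'v"
    and \<alpha> :: "'v \<Rightarrow> 'k" and \<omega> :: "'v \<Rightarrow> 'v \<Rightarrow> 'k"
    and \<phi> :: "'v \<Rightarrow> 'v" and a :: 'v and t :: 'k
  assumes "cosymplectic_JJ_algebra smul mult \<alpha> \<omega>"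
    and "admissible_pair smul mult \<phi> a"
    and "\<alpha> a = 0"
    and "\<forall>x y. form_twist \<omega> \<phi> x y = 0"
    and "\<forall>x. 1 / 2 * \<omega> a x = - \<alpha> (\<phi> x)"
  shows "JJ_algebra (ext_scale smul) (ext_mult smul mult \<omega> \<phi> a)
    \<and> cosymplectic_JJ_algebra (ext_scale smul) (ext_mult smul mult \<omega> \<phi> a)
        (ext_alpha \<alpha> t) (ext_omega \<omega>)"
proof -
  interpret cosymplectic_JJ_algebra smul mult \<alpha> \<omega> by fact
  have "cosymplectic_JJ_algebra (ext_scale smul) (ext_mult smul mult \<omega> \<phi> a)
      (ext_alpha \<alpha> t) (ext_omega \<omega>)"
    using assms(2-5) by (intro ext_cosymplectic_JJ_algebra) blast+
  then show ?thesis
    by (simp add: cosymplectic_JJ_algebra.axioms(1))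
qed

end
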